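(* Let $f\colon \mathbb{R}^n_{>0}\to\mathbb{R}$ be a signomial. If there exists a strict enclosing vector of $\sigma(-f)$, then $V_{>0}^c(f)$ has at most two negative connected components.
   Context: A signomial is a function $f\colon \mathbb{R}^n_{>0}\to\mathbb{R}$, $f(x)=\sum_{\mu\in\sigma(f)}c_\mu x^\mu$, where the support $\sigma(f)\subseteq\mathbb{R}^n$ is a finite set (real exponents allowed), $c_\mu\in\mathbb{R}\setminus\{0\}$, and $x^\mu=x_1^{\mu_1}\cdots x_n^{\mu_n}$. Put $\sigma_+(f)=\{\mu\in\sigma(f)\mid c_\mu>0\}$ and $\sigma_-(f)=\{\mu\in\sigma(f)\mid c_\mu<0\}$. $V_{>0}^c(f)=\{x\in\mathbb{R}^n_{>0}\mid f(x)\neq 0\}$; a connected component of it is negative if $f<0$ on it. For a signomial $g$, a vector $v\in\mathbb{R}^n$ is an enclosing vector of $\sigma(g)$ if for some $a,b\in\mathbb{R}$ with $a\leq b$ one has $a\leq v\cdot\beta\leq b$ for all $\beta\in\sigma_-(g)$, and for every $\alpha\in\sigma_+(g)$ either $v\cdot\alpha\leq a$ or $v\cdot\alpha\geq b$. It is a strict enclosing vector of $\sigma(g)$ if $a,b$ can be chosen so that additionally there exist $\alpha_1,\alpha_2\in\sigma_+(g)$ with $v\cdot\alpha_1<a$ and $v\cdot\alpha_2>b$. In the claim this is applied to $g=-f$, for which $\sigma_-(-f)=\sigma_+(f)$ and $\sigma_+(-f)=\sigma_-(f)$. *)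

theory Defs
  imports "HOL-Analysis.Analysis" "HOL-Library.Poly_Mapping"
begin

text \<open>
  A signomial in n variables is encoded by its finitely supported coefficient function on
  the exponents, with n = \<open>CARD('n)\<close>. The library function \<^const>\<open>Poly_Mapping.keys\<close> collects the exponents
  with nonzero coefficient, so it is the support of the signomial, and the signomial -f is
  \<open>- f\<close>, the pointwise negation of coefficients.
\<close>

type_synonym 'n signomial = "(real ^ 'n) \<Rightarrow>\<^sub>0 real"

definition pos_orthant :: "(real ^ 'n) set" where
  "pos_orthant = {x. \<forall>i. 0 < x $ i}"

definition monomial_at :: "real ^ 'n \<Rightarrow> real ^ 'n \<Rightarrow> real" where
  "monomial_at \<mu> x = (\<Prod>i\<in>UNIV. (x $ i) powr (\<mu> $ i))"

text \<open>The function given by a signomial; only its values on \<open>pos_orthant\<close> are meaningful.\<close>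

definition signomial_eval :: "'n::finite signomial \<Rightarrow> real ^ 'n \<Rightarrow> real" where
  "signomial_eval f x = (\<Sum>\<mu>\<in>Poly_Mapping.keys f. Poly_Mapping.lookup f \<mu> * monomial_at \<mu> x)"

definition pos_support :: "'n::finite signomial \<Rightarrow> (real ^ 'n) set" where
  "pos_support f = {\<mu> \<in> Poly_Mapping.keys f. Poly_Mapping.lookup f \<mu> > 0}"

definition neg_support :: "'n::finite signomial \<Rightarrow> (real ^ 'n) set" where
  "neg_support f = {\<mu> \<in> Poly_Mapping.keys f. Poly_Mapping.lookup f \<mu> < 0}"

definition nonvanishing_set :: "'n::finite signomial \<Rightarrow> (real ^ 'n) set" where
  "nonvanishing_set f = {x \<in> pos_orthant. signomial_eval f x \<noteq> 0}"

definition negative_components :: "'n::finite signomial \<Rightarrow> (real ^ 'n) set set" where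
  "negative_components f =
     {C \<in> components (nonvanishing_set f). \<forall>x\<in>C. signomial_eval f x < 0}"

text \<open>An enclosing vector of g is a v with \<open>encloses_between g v a b\<close> for some a and b.\<close>

definition encloses_between :: "'n::finite signomial \<Rightarrow> real ^ 'n \<Rightarrow> real \<Rightarrow> real \<Rightarrow> bool" where
  "encloses_between g v a b \<longleftrightarrow> a \<le> b
     \<and> (\<forall>\<beta>\<in>neg_support g. a \<le> v \<bullet> \<beta> \<and> v \<bullet> \<beta> \<le> b)
     \<and> (\<forall>\<alpha>\<in>pos_support g. v \<bullet> \<alpha> \<le> a \<or> v \<bullet> \<alpha> \<ge> b)"

definition strict_enclosing_vector :: "'n::finite signomial \<Rightarrow> real ^ 'n \<Rightarrow> bool" where
  "strict_enclosing_vector g v \<longleftrightarrow>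
     (\<exists>a b. encloses_between g v a b
        \<and> (\<exists>\<alpha>\<^sub>1\<in>pos_support g. \<exists>\<alpha>\<^sub>2\<in>pos_support g. v \<bullet> \<alpha>\<^sub>1 < a \<and> v \<bullet> \<alpha>\<^sub>2 > b))"

end

theory Submission
  imports Defs
begin

text \<open>
  In logarithmic coordinates \<open>f\<close> becomes an exponential sum \<open>F\<close>. Restricted to a line in direction
  \<open>v\<close>, its coefficients have at most two sign changes, in the order \<open>-, +, -\<close>, so from every point
  with \<open>F < 0\<close> one of the two rays in directions \<open>v\<close> and \<open>-v\<close> stays in \<open>{F < 0}\<close>. The set of
  points whose \<open>v\<close>-ray stays negative is connected: strictness makes \<open>F\<close> negative far out along
  \<open>v\<close>, uniformly on segments, so two such points are joined by moving out, across and back.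
  The same holds for \<open>-v\<close>, hence \<open>{F < 0}\<close> is a union of two connected sets.
\<close>

section \<open>Exponential sums along lines\<close>

lemma exp_sum_negative_on_half_line:
  fixes d s :: "'a \<Rightarrow> real"
  assumes "a \<le> b"
    and pos: "\<And>i. i \<in> S \<Longrightarrow> 0 < d i \<Longrightarrow> a \<le> s i \<and> s i \<le> b"
    and neg: "\<And>i. i \<in> S \<Longrightarrow> d i < 0 \<Longrightarrow> s i \<le> a \<or> b \<le> s i"
    and at_0: "(\<Sum>i\<in>S. d i) < 0"
  shows "(\<forall>t\<ge>0. (\<Sum>i\<in>S. d i * exp (s i * t)) < 0) \<or> (\<forall>t\<le>0. (\<Sum>i\<in>S. d i * exp (s i * t)) < 0)"
proof -
  \<comment> \<open>If \<open>g\<close> is the sum, \<open>h\<close> is \<open>exp (- a t) g\<close> and \<open>k\<close> is \<open>exp ((a - b) t) h'\<close>. The sign pattern makes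
    \<open>k\<close> nonincreasing, so \<open>h\<close> first increases and then decreases.\<close>
  define h where "h t = (\<Sum>i\<in>S. d i * exp ((s i - a) * t))" for t
  define k where "k t = (\<Sum>i\<in>S. (s i - a) * d i * exp ((s i - b) * t))" for t
  have h_deriv: "(h has_real_derivative exp ((b - a) * t) * k t) (at t)" for t
  proof -
    have "((\<lambda>t. d i * exp ((s i - a) * t)) has_real_derivative
        exp ((b - a) * t) * ((s i - a) * d i * exp ((s i - b) * t))) (at t)" for i
    proof -
      have "exp ((s i - a) * t) = exp ((b - a) * t) * exp ((s i - b) * t)"
        by (simp add: algebra_simps flip: exp_add)
      then show ?thesis by (auto intro!: derivative_eq_intros)
    qed
    then show ?thesis unfolding h_def k_def sum_distrib_left by (rule DERIV_sum)
  qed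
  have k_deriv: "(k has_real_derivative
      (\<Sum>i\<in>S. (s i - a) * (s i - b) * d i * exp ((s i - b) * t))) (at t)" for t
    unfolding k_def by (rule DERIV_sum) (auto intro!: derivative_eq_intros)
  \<comment> \<open>The product \<open>(s i - a) * (s i - b)\<close> is nonpositive for
    \<open>s i\<close> in \<open>[a, b]\<close> and nonnegative for \<open>s i \<le> a\<close> or
    \<open>b \<le> s i\<close>, so its sign opposes that of \<open>d i\<close>.\<close>
  have coeff: "(s i - a) * (s i - b) * d i \<le> 0" if "i \<in> S" for i
  proof (cases "d i" "0::real" rule: linorder_cases)
    case less
    then have "0 \<le> (s i - a) * (s i - b)"
      using neg[OF that less] \<open>a \<le> b\<close> by (auto simp: zero_le_mult_iff)
    then show ?thesis using less by (simp add: mult_le_0_iff)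
  next
    case greater
    then have "(s i - a) * (s i - b) \<le> 0"
      using pos[OF that greater] by (auto simp: mult_le_0_iff)
    then show ?thesis using greater by (simp add: mult_le_0_iff)
  qed simp
  have k_antimono: "k u \<le> k t" if "t \<le> u" for t u
  proof (rule DERIV_nonpos_imp_nonincreasing[OF that])
    fix x
    have "(\<Sum>i\<in>S. (s i - a) * (s i - b) * d i * exp ((s i - b) * x)) \<le> 0"
      by (intro sum_nonpos mult_nonpos_nonneg coeff) auto
    then show "\<exists>y. (k has_real_derivative y) (at x) \<and> y \<le> 0"
      using k_deriv by blast
  qed
  have h_0: "h 0 < 0" using at_0 by (simp add: h_def)
  have "(\<forall>t\<ge>0. h t < 0) \<or> (\<forall>t\<le>0. h t < 0)"
  \<comment> \<open>\<open>k\<close> carries the sign of the derivative of \<open>h\<close>. As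
    \<open>k\<close> is nonincreasing, \<open>k 0 \<le> 0\<close> persists to the right and
    \<open>0 < k 0\<close> to the left; on that half-line \<open>h\<close> stays at or below
    \<open>h 0\<close>.\<close>
  proof (cases "k 0 \<le> 0")
    case True
    have "h t \<le> h 0" if "0 \<le> t" for t
    proof (rule DERIV_nonpos_imp_nonincreasing[OF that])
      fix x :: real assume "0 \<le> x"
      then have "exp ((b - a) * x) * k x \<le> 0"
        using k_antimono[of 0 x] True by (simp add: mult_le_0_iff)
      then show "\<exists>y. (h has_real_derivative y) (at x) \<and> y \<le> 0"
        using h_deriv by blast
    qed
    with h_0 show ?thesis by force
  next
    case False
    have "h t \<le> h 0" if "t \<le> 0" for t
    proof (rule DERIV_nonneg_imp_nondecreasing[OF that])
      fix x :: real assume "x \<le> 0"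
      then have "0 \<le> exp ((b - a) * x) * k x"
        using k_antimono[of x 0] False by simp
      then show "\<exists>y. (h has_real_derivative y) (at x) \<and> 0 \<le> y"
        using h_deriv by blast
    qed
    with h_0 show ?thesis by force
  qed
  moreover have "(\<Sum>i\<in>S. d i * exp (s i * t)) = exp (a * t) * h t" for t
    unfolding h_def sum_distrib_left
    by (intro sum.cong refl) (simp add: algebra_simps flip: exp_add)
  ultimately show ?thesis
    by (simp add: mult_less_0_iff)
qed

text \<open>Along \<open>v\<close> the negative term at \<open>\<alpha>\<close> has growth rate
  \<open>v \<bullet> \<alpha>\<close>, larger than the bound \<open>b\<close> on the rates of all
  positive terms, so it eventually dominates. Compactness of \<open>K\<close> makes the threshold
  independent of \<open>z\<close>.\<close>

lemma exp_sum_uniformly_eventually_negative: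
  fixes c :: "'a::euclidean_space \<Rightarrow> real"
  assumes "finite S" "compact K"
    and pos: "\<And>\<mu>. \<mu> \<in> S \<Longrightarrow> 0 < c \<mu> \<Longrightarrow> v \<bullet> \<mu> \<le> b"
    and \<alpha>: "\<alpha> \<in> S" "c \<alpha> < 0" "b < v \<bullet> \<alpha>"
  obtains T where "0 \<le> T"
    "\<And>z t. z \<in> K \<Longrightarrow> T \<le> t \<Longrightarrow> (\<Sum>\<mu>\<in>S. c \<mu> * exp (\<mu> \<bullet> (z + t *\<^sub>R v))) < 0"
proof -
  define P where "P = {\<mu>\<in>S. 0 < c \<mu>}"
  \<comment> \<open>The ratio of the positive terms to the modulus of the term at
    \<open>\<alpha>\<close>. Moving from \<open>z\<close> by \<open>t *\<^sub>R v\<close> with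
    \<open>t \<ge> 0\<close> shrinks it at least by the factor \<open>exp (- \<delta> * t)\<close>,
    where \<open>\<delta> = v \<bullet> \<alpha> - b\<close>.\<close>
  define q where "q z = (\<Sum>\<mu>\<in>P. c \<mu> * exp (\<mu> \<bullet> z)) / (- c \<alpha> * exp (\<alpha> \<bullet> z))" for z
  have "continuous_on K q"
    unfolding q_def using \<alpha> by (intro continuous_intros) auto
  then have "bounded (q ` K)"
    using \<open>compact K\<close> by (intro compact_imp_bounded compact_continuous_image)
  then obtain B where B: "0 < B" "\<And>z. z \<in> K \<Longrightarrow> \<bar>q z\<bar> \<le> B"
    unfolding bounded_pos by auto
  define \<delta> where "\<delta> = v \<bullet> \<alpha> - b"
  have \<delta>: "0 < \<delta>" using \<alpha> by (simp add: \<delta>_def)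
  \<comment> \<open>For \<open>t \<ge> B / \<delta>\<close> one has
    \<open>exp (\<delta> * t) > \<delta> * t \<ge> B\<close>, which beats the bound \<open>B\<close>
    on \<open>q\<close>.\<close>
  have "(\<Sum>\<mu>\<in>S. c \<mu> * exp (\<mu> \<bullet> (z + t *\<^sub>R v))) < 0" if "z \<in> K" "B / \<delta> \<le> t" for z t
  proof -
    have "0 \<le> B / \<delta>" using B \<delta> by simp
    then have "0 \<le> t" using that by linarith
    have "B < exp (\<delta> * t)"
    proof -
      have "B \<le> \<delta> * t" using that \<delta> by (simp add: field_simps)
      also have "\<dots> < exp (\<delta> * t)" using exp_ge_add_one_self[of "\<delta> * t"] by linarith
      finally show ?thesis .
    qed
    then have "q z < exp (\<delta> * t)" using B(2)[OF that(1)] by linarith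
    moreover have "0 < - c \<alpha> * exp (\<alpha> \<bullet> z)" using \<alpha> by (simp add: mult_neg_pos)
    ultimately have q: "(\<Sum>\<mu>\<in>P. c \<mu> * exp (\<mu> \<bullet> z)) < exp (\<delta> * t) * (- c \<alpha> * exp (\<alpha> \<bullet> z))"
      unfolding q_def by (subst (asm) pos_divide_less_eq)
    have "(\<Sum>\<mu>\<in>S. c \<mu> * exp (\<mu> \<bullet> (z + t *\<^sub>R v)))
        \<le> (\<Sum>\<mu>\<in>insert \<alpha> P. c \<mu> * exp (\<mu> \<bullet> (z + t *\<^sub>R v)))"
    proof -
      have "(\<Sum>\<mu>\<in>S - insert \<alpha> P. c \<mu> * exp (\<mu> \<bullet> (z + t *\<^sub>R v))) \<le> 0"
        by (rule sum_nonpos) (auto simp: P_def mult_le_0_iff not_less)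
      moreover have "insert \<alpha> P \<subseteq> S" using \<alpha> by (auto simp: P_def)
      ultimately show ?thesis
        using sum.subset_diff[of "insert \<alpha> P" S] \<open>finite S\<close> by (metis add_le_same_cancel2)
    qed
    also have "\<dots> = c \<alpha> * exp (\<alpha> \<bullet> (z + t *\<^sub>R v)) + (\<Sum>\<mu>\<in>P. c \<mu> * exp (\<mu> \<bullet> (z + t *\<^sub>R v)))"
      using \<open>finite S\<close> \<alpha> by (subst sum.insert) (auto simp: P_def)
    also have "(\<Sum>\<mu>\<in>P. c \<mu> * exp (\<mu> \<bullet> (z + t *\<^sub>R v))) \<le> (\<Sum>\<mu>\<in>P. exp (b * t) * (c \<mu> * exp (\<mu> \<bullet> z)))"
    proof (rule sum_mono)
      fix \<mu> assume "\<mu> \<in> P"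
      then have "c \<mu> > 0" "v \<bullet> \<mu> \<le> b" using pos by (auto simp: P_def)
      then have "exp (\<mu> \<bullet> (z + t *\<^sub>R v)) \<le> exp (b * t + \<mu> \<bullet> z)"
        using mult_left_mono[OF _ \<open>0 \<le> t\<close>, of "v \<bullet> \<mu>" b]
        by (simp add: inner_add_right inner_commute mult.commute)
      then show "c \<mu> * exp (\<mu> \<bullet> (z + t *\<^sub>R v)) \<le> exp (b * t) * (c \<mu> * exp (\<mu> \<bullet> z))"
        using \<open>c \<mu> > 0\<close> by (simp add: exp_add mult.left_commute)
    qed
    also have "c \<alpha> * exp (\<alpha> \<bullet> (z + t *\<^sub>R v)) + \<dots>
        = exp (b * t) * ((\<Sum>\<mu>\<in>P. c \<mu> * exp (\<mu> \<bullet> z)) - exp (\<delta> * t) * (- c \<alpha> * exp (\<alpha> \<bullet> z)))"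
      by (simp add: \<delta>_def inner_add_right inner_commute algebra_simps sum_distrib_left
          flip: exp_add)
    also have "\<dots> < 0"
      using q by (simp add: mult_less_0_iff)
    finally show ?thesis by simp
  qed
  then show ?thesis
    using that[of "B / \<delta>"] B \<delta> by simp
qed

text \<open>Demanding negativity on the whole ray makes the set stable under translation by
  nonnegative multiples of \<open>v\<close>, so the outward segments from \<open>x\<close> and
  \<open>y\<close> remain in it.\<close>

lemma connected_negative_rays:
  fixes c :: "'a::euclidean_space \<Rightarrow> real"
  assumes "finite S"
    and "\<And>\<mu>. \<mu> \<in> S \<Longrightarrow> 0 < c \<mu> \<Longrightarrow> v \<bullet> \<mu> \<le> b"
    and "\<alpha> \<in> S" "c \<alpha> < 0" "b < v \<bullet> \<alpha>"
  shows "connected {y. \<forall>t\<ge>0. (\<Sum>\<mu>\<in>S. c \<mu> * exp (\<mu> \<bullet> (y + t *\<^sub>R v))) < 0}" (is "connected ?A")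
  unfolding connected_iff_connected_component
proof (intro ballI)
  fix x y assume xy: "x \<in> ?A" "y \<in> ?A"
  \<comment> \<open>A single \<open>T\<close> serves the whole segment from \<open>x\<close> to
    \<open>y\<close>; its translate by \<open>T *\<^sub>R v\<close> therefore lies in
    \<open>?A\<close> and gives the crossing.\<close>
  obtain T where T: "0 \<le> T" "\<And>z t. z \<in> closed_segment x y \<Longrightarrow> T \<le> t \<Longrightarrow>
      (\<Sum>\<mu>\<in>S. c \<mu> * exp (\<mu> \<bullet> (z + t *\<^sub>R v))) < 0"
    using exp_sum_uniformly_eventually_negative[OF assms(1) compact_segment, of c v b \<alpha> x y] assms(2-)
    by metis
  have segment: "connected_component ?A p q" if "closed_segment p q \<subseteq> ?A" for p q
    unfolding connected_component_def using that by (intro exI[of _ "closed_segment p q"]) auto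
  have ray: "p + u *\<^sub>R v \<in> ?A" if "p \<in> ?A" "0 \<le> u" for p u
  proof (intro CollectI allI impI)
    fix t :: real assume "0 \<le> t"
    with that have "(\<Sum>\<mu>\<in>S. c \<mu> * exp (\<mu> \<bullet> (p + (u + t) *\<^sub>R v))) < 0" by auto
    then show "(\<Sum>\<mu>\<in>S. c \<mu> * exp (\<mu> \<bullet> (p + u *\<^sub>R v + t *\<^sub>R v))) < 0"
      by (simp add: scaleR_add_left add.assoc)
  qed
  have out: "connected_component ?A p (p + T *\<^sub>R v)" if "p \<in> ?A" for p
  proof (rule segment, rule subsetI)
    fix w assume "w \<in> closed_segment p (p + T *\<^sub>R v)"
    then obtain u where "0 \<le> u" "w = p + (u * T) *\<^sub>R v"
      by (auto simp: in_segment algebra_simps)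
    then show "w \<in> ?A" using ray[OF that, of "u * T"] T(1) by simp
  qed
  have "connected_component ?A (x + T *\<^sub>R v) (y + T *\<^sub>R v)"
  proof (rule segment, rule subsetI)
    fix w assume "w \<in> closed_segment (x + T *\<^sub>R v) (y + T *\<^sub>R v)"
    then obtain z where z: "z \<in> closed_segment x y" "w = z + T *\<^sub>R v"
      using closed_segment_translation[of "T *\<^sub>R v" x y] by (auto simp: add.commute)
    show "w \<in> ?A"
    proof (intro CollectI allI impI)
      fix t :: real assume "0 \<le> t"
      then have "(\<Sum>\<mu>\<in>S. c \<mu> * exp (\<mu> \<bullet> (z + (T + t) *\<^sub>R v))) < 0" using T z by simp
      then show "(\<Sum>\<mu>\<in>S. c \<mu> * exp (\<mu> \<bullet> (w + t *\<^sub>R v))) < 0"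
        by (simp add: z scaleR_add_left add.assoc)
    qed
  qed
  then show "connected_component ?A x y"
    using out[OF xy(1)] out[OF xy(2)]
    by (meson connected_component_sym connected_component_trans)
qed

section \<open>Signomials in logarithmic coordinates\<close>

definition exp_vec :: "real ^ 'n \<Rightarrow> real ^ 'n" where
  "exp_vec y = (\<chi> i. exp (y $ i))"

lemma continuous_on_exp_vec: "continuous_on A exp_vec"
  unfolding exp_vec_def by (intro continuous_intros)

lemma exp_vec_in_pos_orthant: "exp_vec y \<in> pos_orthant"
  by (simp add: exp_vec_def pos_orthant_def)

lemma pos_orthantE:
  assumes "x \<in> pos_orthant"
  obtains y where "x = exp_vec y"
proof
  show "x = exp_vec (\<chi> i. ln (x $ i))"
    using assms by (simp add: exp_vec_def pos_orthant_def vec_eq_iff)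
qed

lemma signomial_eval_exp_vec:
  "signomial_eval f (exp_vec y)
    = (\<Sum>\<mu>\<in>Poly_Mapping.keys f. Poly_Mapping.lookup f \<mu> * exp (\<mu> \<bullet> y))"
  by (simp add: signomial_eval_def monomial_at_def exp_vec_def powr_def inner_vec_def exp_sum)

lemma pos_support_uminus [simp]: "pos_support (- f) = neg_support f"
  by (auto simp: pos_support_def neg_support_def in_keys_iff)

lemma neg_support_uminus [simp]: "neg_support (- f) = pos_support f"
  by (auto simp: pos_support_def neg_support_def in_keys_iff)

text \<open>Negation reverses the order: \<open>[a, b]\<close> becomes \<open>[-b, -a]\<close> and
  the two strict witnesses exchange roles. Results for direction \<open>v\<close> thus transfer to
  \<open>- v\<close>.\<close>

lemma strict_enclosing_vector_uminus:
  assumes "strict_enclosing_vector g v"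
  shows "strict_enclosing_vector g (- v)"
proof -
  obtain a b \<alpha>\<^sub>1 \<alpha>\<^sub>2 where *: "encloses_between g v a b" "\<alpha>\<^sub>1 \<in> pos_support g" "\<alpha>\<^sub>2 \<in> pos_support g"
    "v \<bullet> \<alpha>\<^sub>1 < a" "v \<bullet> \<alpha>\<^sub>2 > b"
    using assms unfolding strict_enclosing_vector_def by blast
  have "encloses_between g (- v) (- b) (- a)"
    using *(1) unfolding encloses_between_def by (auto simp: le_minus_iff)
  moreover have "(- v) \<bullet> \<alpha>\<^sub>2 < - b" "(- v) \<bullet> \<alpha>\<^sub>1 > - a"
    using * by auto
  ultimately show ?thesis
    using *(2,3) unfolding strict_enclosing_vector_def by blast
qed

definition negative_ray_set :: "'n::finite signomial \<Rightarrow> real ^ 'n \<Rightarrow> (real ^ 'n) set" where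
  "negative_ray_set f v = exp_vec ` {y. \<forall>t\<ge>0. signomial_eval f (exp_vec (y + t *\<^sub>R v)) < 0}"

text \<open>A positive exponent of \<open>- f\<close> is a negative one of \<open>f\<close>, so the
  strict witness above \<open>b\<close> is the dominating negative term along
  \<open>v\<close>.\<close>

lemma connected_negative_ray_set:
  assumes "strict_enclosing_vector (- f) v"
  shows "connected (negative_ray_set f v)"
proof -
  obtain a b \<alpha> where enc: "encloses_between (- f) v a b"
    and \<alpha>: "\<alpha> \<in> pos_support (- f)" "b < v \<bullet> \<alpha>"
    using assms unfolding strict_enclosing_vector_def by blast
  have "v \<bullet> \<mu> \<le> b" if "\<mu> \<in> Poly_Mapping.keys f" "0 < Poly_Mapping.lookup f \<mu>" for \<mu>
    using enc that by (auto simp: encloses_between_def pos_support_def)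
  with \<alpha> show ?thesis
    unfolding negative_ray_set_def signomial_eval_exp_vec
    by (intro connected_continuous_image continuous_on_exp_vec connected_negative_rays)
      (auto simp: neg_support_def)
qed

lemma negative_ray_set_subset: "negative_ray_set f v \<subseteq> nonvanishing_set f"
proof
  fix x assume "x \<in> negative_ray_set f v"
  then obtain y where y: "x = exp_vec y"
    "\<forall>t\<ge>0. signomial_eval f (exp_vec (y + t *\<^sub>R v)) < 0"
    unfolding negative_ray_set_def by blast
  from y(2)[rule_format, of 0] show "x \<in> nonvanishing_set f"
    by (simp add: y(1) nonvanishing_set_def exp_vec_in_pos_orthant)
qed

lemma negative_point_in_negative_ray_set:
  assumes "strict_enclosing_vector (- f) v" "x \<in> pos_orthant" "signomial_eval f x < 0"
  shows "x \<in> negative_ray_set f v \<or> x \<in> negative_ray_set f (- v)"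
proof -
  obtain a b where enc: "encloses_between (- f) v a b"
    using assms(1) unfolding strict_enclosing_vector_def by blast
  obtain y where y: "x = exp_vec y" using assms(2) by (rule pos_orthantE)
  \<comment> \<open>On the line through \<open>y\<close> the sum has coefficients
    \<open>?d \<mu>\<close> and rates \<open>v \<bullet> \<mu>\<close>. The factor
    \<open>exp (\<mu> \<bullet> y)\<close> is positive, so the signs are those of the coefficients
    of \<open>f\<close>.\<close>
  let ?d = "\<lambda>\<mu>. Poly_Mapping.lookup f \<mu> * exp (\<mu> \<bullet> y)"
  have eval: "signomial_eval f (exp_vec (y + t *\<^sub>R v))
      = (\<Sum>\<mu>\<in>Poly_Mapping.keys f. ?d \<mu> * exp (v \<bullet> \<mu> * t))" for t
    by (simp add: signomial_eval_exp_vec inner_add_right exp_add inner_commute mult_ac)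
  have "(\<forall>t\<ge>0. signomial_eval f (exp_vec (y + t *\<^sub>R v)) < 0)
      \<or> (\<forall>t\<le>0. signomial_eval f (exp_vec (y + t *\<^sub>R v)) < 0)"
    unfolding eval
  proof (rule exp_sum_negative_on_half_line[where a = a and b = b])
    show "a \<le> b" using enc by (simp add: encloses_between_def)
    show "a \<le> v \<bullet> \<mu> \<and> v \<bullet> \<mu> \<le> b" if "\<mu> \<in> Poly_Mapping.keys f" "0 < ?d \<mu>" for \<mu>
      using enc that
      by (auto simp: encloses_between_def pos_support_def zero_less_mult_iff)
    show "v \<bullet> \<mu> \<le> a \<or> b \<le> v \<bullet> \<mu>" if "\<mu> \<in> Poly_Mapping.keys f" "?d \<mu> < 0" for \<mu>
      using enc that
      by (auto simp: encloses_between_def neg_support_def mult_less_0_iff)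
    show "(\<Sum>\<mu>\<in>Poly_Mapping.keys f. ?d \<mu>) < 0"
      using assms(3) by (simp add: y signomial_eval_exp_vec)
  qed
  then show ?thesis
  proof
    assume neg: "\<forall>t\<le>0. signomial_eval f (exp_vec (y + t *\<^sub>R v)) < 0"
    have "signomial_eval f (exp_vec (y + t *\<^sub>R (- v))) < 0" if "0 \<le> t" for t
      using neg[rule_format, of "- t"] that by simp
    then show ?thesis unfolding negative_ray_set_def y by blast
  qed (auto simp: negative_ray_set_def y)
qed

section \<open>Counting components\<close>

text \<open>A connected subset of \<open>U\<close> that meets a component lies inside it, so
  \<open>A\<close> and \<open>B\<close> each meet at most one member of \<open>\<C>\<close>.
  Finiteness is stated separately because \<open>card\<close> of an infinite set is 0.\<close>

lemma card_components_le_2: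
  assumes "\<C> \<subseteq> components U" "connected A" "connected B" "A \<subseteq> U" "B \<subseteq> U"
    and meets: "\<And>C. C \<in> \<C> \<Longrightarrow> C \<inter> A \<noteq> {} \<or> C \<inter> B \<noteq> {}"
  shows "finite \<C> \<and> card \<C> \<le> 2"
proof -
  have unique: "C = D"
    if "connected X" "X \<subseteq> U" "C \<in> \<C>" "D \<in> \<C>" "C \<inter> X \<noteq> {}" "D \<inter> X \<noteq> {}" for X C D
  proof -
    have "X \<subseteq> C" "X \<subseteq> D"
      using components_maximal[of _ U X] that assms(1) by blast+
    then have "C \<inter> D \<noteq> {}" using that by blast
    then show ?thesis using components_nonoverlap[of C U D] that assms(1) by blast
  qed
  \<comment> \<open>This form also covers the case where no member of \<open>\<C>\<close> meets
    \<open>X\<close>; then \<open>C\<close> is arbitrary and need not belong to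
    \<open>\<C>\<close>.\<close>
  have "\<exists>C. \<forall>D\<in>\<C>. D \<inter> X \<noteq> {} \<longrightarrow> D = C" if "connected X" "X \<subseteq> U" for X
    using unique[OF that] by metis
  then obtain C D where CD: "\<forall>E\<in>\<C>. E \<inter> A \<noteq> {} \<longrightarrow> E = C" "\<forall>E\<in>\<C>. E \<inter> B \<noteq> {} \<longrightarrow> E = D"
    using assms(2-5) by metis
  have sub: "\<C> \<subseteq> {C, D}"
  proof
    fix E assume "E \<in> \<C>"
    with meets[OF this] CD show "E \<in> {C, D}" by auto
  qed
  then have "card \<C> \<le> card {C, D}" by (intro card_mono) auto
  also have "\<dots> \<le> 2" by (simp add: card_insert_if)
  finally show ?thesis using finite_subset[OF sub] by simp
qed

theorem theorem3p8:
  fixes f :: "'n::finite signomial"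
  assumes "\<exists>v. strict_enclosing_vector (- f) v"
  shows "finite (negative_components f) \<and> card (negative_components f) \<le> 2"
proof -
  obtain v where v: "strict_enclosing_vector (- f) v" using assms by blast
  show ?thesis
  proof (rule card_components_le_2)
    show "negative_components f \<subseteq> components (nonvanishing_set f)"
      by (auto simp: negative_components_def)
    show "connected (negative_ray_set f v)" "connected (negative_ray_set f (- v))"
      using v by (auto intro: connected_negative_ray_set strict_enclosing_vector_uminus)
    show "negative_ray_set f v \<subseteq> nonvanishing_set f" "negative_ray_set f (- v) \<subseteq> nonvanishing_set f"
      by (rule negative_ray_set_subset)+
    \<comment> \<open>Components are nonempty, so \<open>C\<close> contains a point where
      \<open>f\<close> is negative, and this point lies in one of the two ray sets.\<close>
    fix C assume C: "C \<in> negative_components f"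
    then obtain x where "x \<in> C" "x \<in> nonvanishing_set f" "signomial_eval f x < 0"
      using in_components_nonempty[of C "nonvanishing_set f"]
        in_components_subset[of C "nonvanishing_set f"]
      unfolding negative_components_def by blast
    then show "C \<inter> negative_ray_set f v \<noteq> {} \<or> C \<inter> negative_ray_set f (- v) \<noteq> {}"
      using negative_point_in_negative_ray_set[OF v] unfolding nonvanishing_set_def by blast
  qed
qed

end
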